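(* Let $G$ be a connected graph and let $X$ be a general position set of $G$. Then $X$ is a dual general position set of $G$ if and only if $G-X$ is convex in $G$.
   Context: All graphs are finite, simple and connected unless stated otherwise. For $X\subseteq V(G)$, vertices $u,v\in V(G)$ are $X$-positionable if for every shortest $u,v$-path $P$ in $G$ we have $V(P)\cap X\subseteq\{u,v\}$. A set $X\subseteq V(G)$ is a general position set if every $u,v\in X$ are $X$-positionable; it is a dual general position set if every $u,v\in X$ are $X$-positionable and every $u,v\in V(G)\setminus X$ are $X$-positionable. $G-X$ is the subgraph of $G$ obtained by deleting all vertices of $X$. A subgraph $G'$ of $G$ is convex if for every two vertices of $G'$, every shortest path in $G$ between them lies completely in $G'$ (the empty subgraph is vacuously convex). *)

theory Defs
  imports "Graph_Theory.Digraph_Component"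
begin

text \<open>
  As in the underlying library, a finite simple graph is a finite symmetric digraph without
  loops and parallel arcs (locale \<open>graph\<close>): an edge is a pair of opposite arcs. A path is an
  arc list together with its end vertices; its vertex list is \<open>awalk_verts\<close>.
\<close>

definition shortest_path :: "('a, 'b) pre_digraph \<Rightarrow> 'a \<Rightarrow> 'b awalk \<Rightarrow> 'a \<Rightarrow> bool" where
  "shortest_path G u p v \<longleftrightarrow>
     pre_digraph.apath G u p v \<and> (\<forall>q. pre_digraph.apath G u q v \<longrightarrow> length p \<le> length q)"

definition positionable :: "('a, 'b) pre_digraph \<Rightarrow> 'a set \<Rightarrow> 'a \<Rightarrow> 'a \<Rightarrow> bool" where
  "positionable G X u v \<longleftrightarrow>
     (\<forall>p. shortest_path G u p v \<longrightarrow> set (pre_digraph.awalk_verts G u p) \<inter> X \<subseteq> {u, v})"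

definition general_position_set :: "('a, 'b) pre_digraph \<Rightarrow> 'a set \<Rightarrow> bool" where
  "general_position_set G X \<longleftrightarrow>
     X \<subseteq> verts G \<and> (\<forall>u \<in> X. \<forall>v \<in> X. positionable G X u v)"

definition dual_general_position_set :: "('a, 'b) pre_digraph \<Rightarrow> 'a set \<Rightarrow> bool" where
  "dual_general_position_set G X \<longleftrightarrow>
     X \<subseteq> verts G \<and>
     (\<forall>u \<in> X. \<forall>v \<in> X. positionable G X u v) \<and>
     (\<forall>u \<in> verts G - X. \<forall>v \<in> verts G - X. positionable G X u v)"

definition delete_verts :: "('a, 'b) pre_digraph \<Rightarrow> 'a set \<Rightarrow> ('a, 'b) pre_digraph" where
  "delete_verts G X = G \<restriction> (verts G - X)"

text \<open>
  Shortest paths are taken in the ambient graph \<open>G\<close>; both the vertices and the arcs of such a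
  path have to belong to the subgraph \<open>H\<close>.
\<close>
definition convex_subgraph :: "('a, 'b) pre_digraph \<Rightarrow> ('a, 'b) pre_digraph \<Rightarrow> bool" where
  "convex_subgraph H G \<longleftrightarrow>
     subgraph H G \<and>
     (\<forall>u \<in> verts H. \<forall>v \<in> verts H. \<forall>p. shortest_path G u p v \<longrightarrow>
        set (pre_digraph.awalk_verts G u p) \<subseteq> verts H \<and> set p \<subseteq> arcs H)"

end

theory Submission
  imports Defs
begin

text \<open>For endpoints outside \<open>X\<close>, a shortest path meets \<open>X\<close> at most
  in its endpoints exactly when it avoids \<open>X\<close>, that is, when its vertices lie in
  \<open>G - X\<close>. As \<open>G - X\<close> is induced, its arcs then lie there too. So
  convexity of \<open>G - X\<close> is positionability of all pairs outside \<open>X\<close>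
  (\<open>convex_delete_verts_iff\<close>), which is just what a general position set must satisfy
  in addition to be dual.\<close>

lemma (in wf_digraph) subgraph_delete_verts: "subgraph (delete_verts G X) G"
  unfolding delete_verts_def by (intro induced_imp_subgraph induced_induce) auto

text \<open>Both ends of each arc of a walk are vertices of the walk, and an induced subgraph keeps
  every arc with both ends in \<open>S\<close>. This makes the arc condition of convexity follow
  from the vertex condition.\<close>

lemma (in wf_digraph) awalk_in_induce_subgraph:
  assumes "awalk u p v" and "set (awalk_verts u p) \<subseteq> S"
  shows "set p \<subseteq> arcs (G \<restriction> S)"
proof
  fix e assume e: "e \<in> set p"
  have "tail G e \<in> set (awalk_verts u p)" "head G e \<in> set (awalk_verts u p)"
    using e assms(1) by (auto simp: set_awalk_verts)
  moreover have "e \<in> arcs G" using e assms(1) by auto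
  ultimately show "e \<in> arcs (G \<restriction> S)" using assms(2) by auto
qed

lemma (in wf_digraph) shortest_path_awalk: "shortest_path G u p v \<Longrightarrow> awalk u p v"
  by (simp add: shortest_path_def apath_def)

lemma (in wf_digraph) convex_delete_verts_iff:
  "convex_subgraph (delete_verts G X) G \<longleftrightarrow>
     (\<forall>u \<in> verts G - X. \<forall>v \<in> verts G - X. positionable G X u v)"
proof -
  have "positionable G X u v \<longleftrightarrow>
      (\<forall>p. shortest_path G u p v \<longrightarrow> set (awalk_verts u p) \<subseteq> verts (delete_verts G X) \<and>
         set p \<subseteq> arcs (delete_verts G X))"
    if "u \<in> verts G - X" "v \<in> verts G - X" for u v
  proof -
    have "set (awalk_verts u p) \<inter> X \<subseteq> {u, v} \<longleftrightarrow>
        set (awalk_verts u p) \<subseteq> verts (delete_verts G X) \<and> set p \<subseteq> arcs (delete_verts G X)"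
      if "shortest_path G u p v" for p
    proof -
      have p: "awalk u p v" using that by (rule shortest_path_awalk)
      \<comment> \<open>Since \<open>u\<close> and \<open>v\<close> are not in \<open>X\<close>, the
        left side forces the intersection to be empty.\<close>
      have "set (awalk_verts u p) \<inter> X \<subseteq> {u, v} \<longleftrightarrow> set (awalk_verts u p) \<subseteq> verts G - X"
        using p \<open>u \<in> verts G - X\<close> \<open>v \<in> verts G - X\<close> by auto
      then show ?thesis
        using awalk_in_induce_subgraph[OF p] by (auto simp: delete_verts_def)
    qed
    then show ?thesis unfolding positionable_def by blast
  qed
  moreover have "verts (delete_verts G X) = verts G - X"
    by (simp add: delete_verts_def)
  ultimately show ?thesis
    unfolding convex_subgraph_def using subgraph_delete_verts by simp
qed

theorem theorem3p1:
  fixes G :: "('a, 'b) pre_digraph" and X :: "'a set"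
  assumes "Digraph.graph G"
    and "Digraph_Component.connected G"
    and "general_position_set G X"
  shows "dual_general_position_set G X \<longleftrightarrow> convex_subgraph (delete_verts G X) G"
proof -
  interpret Digraph.graph G by (rule assms(1))
  show ?thesis
    \<comment> \<open>General position supplies the pairs inside \<open>X\<close>; the pairs outside
      are the rewritten convexity.\<close>
    using assms(3)
    unfolding convex_delete_verts_iff dual_general_position_set_def general_position_set_def
    by blast
qed

end
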